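(* Let $G,H$ be $N$-player partizan games. Suppose that for every Left option $G^L$ of $G$ there is a Left option $H^L$ of $H$ with $G^L\le_L H^L$, and that for every $1\le i\le N-1$ and every $C_i$-option $H^{C_i}$ of $H$ there is a $C_i$-option $G^{C_i}$ of $G$ with $G^{C_i}\le_L H^{C_i}$. Then $G\le_L H$.
   Context: An $N$-player partizan game ($N\ge2$) is an ordered $N$-tuple $(\mathscr G^{C_0},\dots,\mathscr G^{C_{N-1}})$ of finite sets of partizan games (no infinite runs); players Left $=C_0$, $C_1,\dots,C_{N-2}$, Right $=C_{N-1}$ move cyclically (Left after Right), $\mathscr G^{C_i}$ being the options for $C_i$. Under normal play, a player with no option on their turn is the unique loser and all others win. The disjunctive sum $G+H$ has $C_i$-options $G^{C_i}+H$ and $G+H^{C_i}$. "Left has a winning strategy in $G$ moving $i$th" ($1\le i\le N$) means that when play starts with the player for whom Left is $i$th to move, Left can guarantee not being the loser. $G\le_L H$ means: for every game $X$ and every $1\le i\le N$, if Left has a winning strategy in $G+X$ moving $i$th then Left has one in $H+X$ moving $i$th. *)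

theory Defs
  imports Main "HOL-Library.FSet"
begin

text \<open>
  Players are numbered \<open>0, \<dots>, N - 1\<close>; Left is \<open>0\<close> and Right is \<open>N - 1\<close>.
  \<open>opts G i\<close> is the set of options of player \<open>i\<close>. The type itself does not bound the number
  of players: an \<open>N\<close>-tuple is a family that is empty from index \<open>N\<close> on, hereditarily, which is
  what \<open>is_game N\<close> expresses. There are no infinite runs since \<open>game\<close> is an inductive datatype
  (see \<open>wf_option_rel\<close>).
\<close>

datatype game = Game (opts: "nat \<Rightarrow> game fset")

inductive is_game :: "nat \<Rightarrow> game \<Rightarrow> bool" for N :: nat where
  "(\<And>i. N \<le> i \<Longrightarrow> opts G i = {||}) \<Longrightarrow> (\<And>i G'. G' |\<in>| opts G i \<Longrightarrow> is_game N G') \<Longrightarrow> is_game N G"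

definition option_rel :: "(game \<times> game) set" where
  "option_rel = {(G', G). \<exists>i. G' |\<in>| opts G i}"

lemma wf_option_rel: "wf option_rel"
proof (rule wfUNIVI)
  fix P :: "game \<Rightarrow> bool" and G :: game
  assume step: "\<forall>x. (\<forall>y. (y, x) \<in> option_rel \<longrightarrow> P y) \<longrightarrow> P x"
  show "P G"
  proof (induction G)
    case (Game f)
    have "P y" if "(y, Game f) \<in> option_rel" for y
      using that Game by (auto simp: option_rel_def)
    then show ?case using step by blast
  qed
qed

function gsum :: "game \<Rightarrow> game \<Rightarrow> game"  (infixl "\<oplus>" 65) where
  "G \<oplus> H = Game (\<lambda>i. (\<lambda>G'. G' \<oplus> H) |`| opts G i |\<union>| (\<lambda>H'. G \<oplus> H') |`| opts H i)"
  by pat_completeness auto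
termination
  by (relation "option_rel <*lex*> option_rel")
     (auto intro: wf_option_rel simp: option_rel_def[THEN eqset_imp_iff])

declare gsum.simps [simp del]

lemma opts_gsum:
  "opts (G \<oplus> H) i = (\<lambda>G'. G' \<oplus> H) |`| opts G i |\<union>| (\<lambda>H'. G \<oplus> H') |`| opts H i"
  by (subst gsum.simps) simp

text \<open>
  A history is the nonempty list of positions visited so far, the current one last.
  \<open>turn N p h\<close> is the player to move after history \<open>h\<close> when player \<open>p\<close> made the first move.
\<close>

definition turn :: "nat \<Rightarrow> nat \<Rightarrow> game list \<Rightarrow> nat" where
  "turn N p h = (p + (length h - 1)) mod N"

definition left_strategy :: "(game list \<Rightarrow> game) \<Rightarrow> bool" where
  "left_strategy \<sigma> \<longleftrightarrow>
    (\<forall>h. h \<noteq> [] \<longrightarrow> opts (last h) 0 \<noteq> {||} \<longrightarrow> \<sigma> h |\<in>| opts (last h) 0)"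

text \<open>The histories that can arise from \<open>G\<close>, with \<open>p\<close> starting, when Left plays according to \<open>\<sigma>\<close>.\<close>

inductive history :: "nat \<Rightarrow> nat \<Rightarrow> game \<Rightarrow> (game list \<Rightarrow> game) \<Rightarrow> game list \<Rightarrow> bool"
  for N :: nat and p :: nat and G :: game and \<sigma> :: "game list \<Rightarrow> game" where
  start: "history N p G \<sigma> [G]"
| move: "history N p G \<sigma> h \<Longrightarrow> G' |\<in>| opts (last h) (turn N p h) \<Longrightarrow>
    (turn N p h = 0 \<Longrightarrow> G' = \<sigma> h) \<Longrightarrow> history N p G \<sigma> (h @ [G'])"

text \<open>Normal play: the unique loser is the player to move when that player has no option.\<close>

definition loses :: "nat \<Rightarrow> nat \<Rightarrow> game list \<Rightarrow> nat \<Rightarrow> bool" where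
  "loses N p h c \<longleftrightarrow> turn N p h = c \<and> opts (last h) c = {||}"

definition left_wins_from :: "nat \<Rightarrow> nat \<Rightarrow> game \<Rightarrow> bool" where
  "left_wins_from N p G \<longleftrightarrow>
    (\<exists>\<sigma>. left_strategy \<sigma> \<and> (\<forall>h. history N p G \<sigma> h \<longrightarrow> \<not> loses N p h 0))"

text \<open>Left is \<open>i\<close>th to move (\<open>1 \<le> i \<le> N\<close>) iff the starting player \<open>p\<close> satisfies \<open>p + (i - 1) \<equiv> 0\<close> modulo \<open>N\<close>.\<close>

definition left_wins_moving :: "nat \<Rightarrow> nat \<Rightarrow> game \<Rightarrow> bool" where
  "left_wins_moving N i G \<longleftrightarrow> left_wins_from N ((N + 1 - i) mod N) G"

definition le_left :: "nat \<Rightarrow> game \<Rightarrow> game \<Rightarrow> bool" where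
  "le_left N G H \<longleftrightarrow>
    (\<forall>X. is_game N X \<longrightarrow> (\<forall>i\<in>{1..N}.
      left_wins_moving N i (G \<oplus> X) \<longrightarrow> left_wins_moving N i (H \<oplus> X)))"

end

theory Submission imports Defs begin

text \<open>
  That Left wins moving in a given turn is determined position by position (\<open>wins\<close> below), so a
  strategy for \<open>H \<oplus> X\<close> can be assembled by induction on \<open>X\<close>: a move in \<open>X\<close> is handled by the
  induction hypothesis, while a move of Left in \<open>G\<close> or of another player in \<open>H\<close> is answered by the
  corresponding hypothesis on options, tested against the same \<open>X\<close>.
\<close>

text \<open>Here \<open>p\<close> is the player to move. The base case is \<open>other\<close> with
  no options: a stuck opponent loses, so Left is safe. No rule covers a stuck Left. As runs are
  finite, the least fixed point loses nothing.\<close>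

inductive wins :: "nat \<Rightarrow> nat \<Rightarrow> game \<Rightarrow> bool" for N :: nat where
  left: "G' |\<in>| opts G 0 \<Longrightarrow> wins N (Suc 0 mod N) G' \<Longrightarrow> wins N 0 G"
| other: "p \<noteq> 0 \<Longrightarrow> (\<And>G'. G' |\<in>| opts G p \<Longrightarrow> wins N (Suc p mod N) G') \<Longrightarrow> wins N p G"

lemma wins_0_iff: "wins N 0 G \<longleftrightarrow> (\<exists>G'. G' |\<in>| opts G 0 \<and> wins N (Suc 0 mod N) G')"
  by (subst wins.simps) auto

lemma wins_pos_iff:
  "p \<noteq> 0 \<Longrightarrow> wins N p G \<longleftrightarrow> (\<forall>G'. G' |\<in>| opts G p \<longrightarrow> wins N (Suc p mod N) G')"
  by (subst wins.simps) auto

lemma turn_snoc: "h \<noteq> [] \<Longrightarrow> turn N p (h @ [G']) = Suc (turn N p h) mod N"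
  by (cases h) (auto simp: turn_def mod_Suc_eq)

lemma history_nonempty: "history N p G \<sigma> h \<Longrightarrow> h \<noteq> []"
  by (induction rule: history.induct) auto

text \<open>A strategy may depend on the whole history, so the claim is generalised to every history
  consistent with it, and the induction is on the current position.\<close>

lemma wins_if_left_wins_from:
  assumes "p < N" and "left_wins_from N p G"
  shows "wins N p G"
proof -
  obtain \<sigma> where strat: "left_strategy \<sigma>"
    and safe: "\<And>h. history N p G \<sigma> h \<Longrightarrow> \<not> loses N p h 0"
    using assms(2) by (auto simp: left_wins_from_def)
  have "wins N (turn N p h) K" if "history N p G \<sigma> h" "last h = K" for h K
    using wf_option_rel that
  proof (induction K arbitrary: h rule: wf_induct_rule)
    case (less K)
    note ne = history_nonempty[OF less.prems(1)]
    have step: "wins N (Suc (turn N p h) mod N) K'"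
      if "K' |\<in>| opts K (turn N p h)" "turn N p h = 0 \<Longrightarrow> K' = \<sigma> h" for K'
    proof -
      have "history N p G \<sigma> (h @ [K'])"
        using history.move[OF less.prems(1)] less.prems(2) that by auto
      moreover have "(K', K) \<in> option_rel" using that by (auto simp: option_rel_def)
      ultimately show ?thesis using less.IH turn_snoc[OF ne] by fastforce
    qed
    show ?case
    proof (cases "turn N p h = 0")
      case True
      \<comment> \<open>Left is to move and does not lose at \<open>h\<close>, so an option exists
        and a legal strategy must pick one.\<close>
      have "\<sigma> h |\<in>| opts K 0"
        using strat safe[OF less.prems(1)] ne True less.prems(2)
        by (auto simp: left_strategy_def loses_def)
      then show ?thesis using step[of "\<sigma> h"] True by (auto intro: wins.left)
    next
      case False
      then show ?thesis using step by (auto intro: wins.other)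
    qed
  qed
  from this[OF history.start] show ?thesis using assms(1) by (simp add: turn_def)
qed

text \<open>A positional strategy suffices: from a won position move to a won position. Being won is
  then an invariant of all consistent histories, and it rules out a stuck Left.\<close>

lemma left_wins_from_if_wins:
  assumes "p < N" and "wins N p G"
  shows "left_wins_from N p G"
proof -
  \<comment> \<open>Legality is demanded after every nonempty history, so a choice is also needed at
    positions that are not won; there any option is good.\<close>
  define good where "good K K' \<longleftrightarrow> K' |\<in>| opts K 0 \<and>
    (wins N 0 K \<longrightarrow> wins N (Suc 0 mod N) K')" for K K'
  define \<sigma> :: "game list \<Rightarrow> game" where "\<sigma> h = (SOME K'. good (last h) K')" for h
  have good: "good (last h) (\<sigma> h)" if "opts (last h) 0 \<noteq> {||}" for h
  proof -
    have "\<exists>K'. good (last h) K'"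
      using that unfolding good_def wins_0_iff by (metis all_not_fin_conv)
    then show ?thesis unfolding \<sigma>_def by (rule someI_ex)
  qed
  have "wins N (turn N p h) (last h)" if "history N p G \<sigma> h" for h
    using that
  proof induction
    case start
    then show ?case using assms by (simp add: turn_def)
  next
    case (move h G')
    have "wins N (Suc (turn N p h) mod N) G'"
    proof (cases "turn N p h = 0")
      case True
      then have "good (last h) G'" using move good[of h] by auto
      then show ?thesis using move.IH True by (simp add: good_def)
    next
      case False
      then show ?thesis using move wins_pos_iff by blast
    qed
    then show ?case using turn_snoc[OF history_nonempty[OF move.hyps(1)]] by simp
  qed
  then have "\<not> loses N p h 0" if "history N p G \<sigma> h" for h
    using that wins_0_iff by (fastforce simp: loses_def)
  moreover have "left_strategy \<sigma>"
    using good by (simp add: left_strategy_def good_def)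
  ultimately show ?thesis unfolding left_wins_from_def by blast
qed

lemma left_wins_from_iff_wins: "p < N \<Longrightarrow> left_wins_from N p G \<longleftrightarrow> wins N p G"
  using wins_if_left_wins_from left_wins_from_if_wins by blast

lemma le_left_iff_wins:
  assumes "N \<ge> 1"
  shows "le_left N G H \<longleftrightarrow>
    (\<forall>X. is_game N X \<longrightarrow> (\<forall>p<N. wins N p (G \<oplus> X) \<longrightarrow> wins N p (H \<oplus> X)))"
proof -
  have "(\<forall>i\<in>{1..N}. P ((N + 1 - i) mod N)) \<longleftrightarrow> (\<forall>p<N. P p)" for P
  proof (intro iffI allI impI ballI)
    fix p assume all: "\<forall>i\<in>{1..N}. P ((N + 1 - i) mod N)" and "p < N"
    \<comment> \<open>Inverts the map from Left's place in the order to the starting player. Player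
      0 is separate because \<open>N + 1 - 0\<close> lies outside \<open>{1..N}\<close>.\<close>
    define i where "i = (if p = 0 then 1 else N + 1 - p)"
    have "i \<in> {1..N}" "(N + 1 - i) mod N = p"
      using \<open>p < N\<close> assms by (auto simp: i_def)
    then show "P p" using all by metis
  qed (use assms in auto)
  from this[of "\<lambda>p. left_wins_from N p (G \<oplus> X) \<longrightarrow> left_wins_from N p (H \<oplus> X)" for X]
  show ?thesis unfolding le_left_def left_wins_moving_def
    by (simp add: left_wins_from_iff_wins)
qed

theorem mainTheorem15:
  fixes N :: nat and G H :: game
  assumes "N \<ge> 2"
    and "is_game N G" and "is_game N H"
    and "\<And>GL. GL |\<in>| opts G 0 \<Longrightarrow> \<exists>HL. HL |\<in>| opts H 0 \<and> le_left N GL HL"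
    and "\<And>i HC. 1 \<le> i \<Longrightarrow> i \<le> N - 1 \<Longrightarrow> HC |\<in>| opts H i \<Longrightarrow>
           \<exists>GC. GC |\<in>| opts G i \<and> le_left N GC HC"
  shows "le_left N G H"
proof -
  have N: "N \<ge> 1" using assms(1) by simp
  note le_iff = le_left_iff_wins[OF N]
  have "wins N p (H \<oplus> X)" if "is_game N X" "p < N" "wins N p (G \<oplus> X)" for X p
    using wf_option_rel that
  \<comment> \<open>The starting player stays arbitrary because the induction hypothesis is applied
    to the next player, \<open>?q\<close>.\<close>
  proof (induction X arbitrary: p rule: wf_induct_rule)
    case (less X)
    let ?q = "Suc p mod N"
    have q: "?q < N" using N by simp
    have IH: "wins N ?q (H \<oplus> X')" if "X' |\<in>| opts X i" "wins N ?q (G \<oplus> X')" for X' i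
    proof (rule less.IH[OF _ _ q that(2)])
      show "(X', X) \<in> option_rel" using that by (auto simp: option_rel_def)
      show "is_game N X'" using less.prems(1) that(1) by (auto elim: is_game.cases)
    qed
    \<comment> \<open>Replacing a component by a larger one needs no descent: \<open>le_left\<close>
      already covers this very \<open>X\<close> and every starting player.\<close>
    have le: "wins N ?q (B \<oplus> X)" if "le_left N A B" "wins N ?q (A \<oplus> X)" for A B
      using that le_iff less.prems(1) q by blast
    show ?case
    proof (cases "p = 0")
      case True
      then obtain K where K: "K |\<in>| opts (G \<oplus> X) 0" "wins N ?q K"
        using less.prems(3) wins_0_iff by auto
      then consider GL where "GL |\<in>| opts G 0" "K = GL \<oplus> X"
        | X' where "X' |\<in>| opts X 0" "K = G \<oplus> X'"
        by (auto simp: opts_gsum)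
      then have "\<exists>K'. K' |\<in>| opts (H \<oplus> X) 0 \<and> wins N ?q K'"
      proof cases
        case 1
        then obtain HL where "HL |\<in>| opts H 0" "le_left N GL HL" using assms(4) by blast
        then show ?thesis using le K(2) 1(2) by (auto simp: opts_gsum)
      next
        case 2
        then show ?thesis using IH K(2) by (auto simp: opts_gsum)
      qed
      then show ?thesis using True wins_0_iff by auto
    next
      case False
      \<comment> \<open>Left survives every move of an opponent in \<open>G \<oplus> X\<close>, so
        each opposing move in \<open>H \<oplus> X\<close> need only be matched with one
        there.\<close>
      have G_opt: "wins N ?q K" if "K |\<in>| opts (G \<oplus> X) p" for K
        using less.prems(3) False that wins_pos_iff by blast
      have "wins N ?q K" if "K |\<in>| opts (H \<oplus> X) p" for K
      proof -
        from that consider HC where "HC |\<in>| opts H p" "K = HC \<oplus> X"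
          | X' where "X' |\<in>| opts X p" "K = H \<oplus> X'"
          by (auto simp: opts_gsum)
        then show ?thesis
        proof cases
          case 1
          moreover have "1 \<le> p" "p \<le> N - 1" using False less.prems(2) by auto
          ultimately obtain GC where "GC |\<in>| opts G p" "le_left N GC HC"
            using assms(5) by blast
          then show ?thesis using le G_opt[of "GC \<oplus> X"] 1(2) by (auto simp: opts_gsum)
        next
          case 2
          then show ?thesis using IH G_opt[of "G \<oplus> X'"] by (auto simp: opts_gsum)
        qed
      qed
      then show ?thesis using False wins_pos_iff by blast
    qed
  qed
  then show ?thesis using le_iff by blast
qed

end
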